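(* Let $\mathcal H$ be a real Hilbert space, let $\mu\in\,]0,\infty[$, let $n\ge 1$ be an integer, $I=\{1,\dots,n\}$, and let $\lambda_i>0$ ($i\in I$) satisfy $\sum_{i\in I}\lambda_i=1$. For each $i\in I$ let $A_i:\mathcal H\rightrightarrows\mathcal H$ be rectangular and maximally monotone, and write $\mathbf A=(A_1,\dots,A_n)$, $\boldsymbol\lambda=(\lambda_1,\dots,\lambda_n)$. Then $\mathcal R_\mu(\mathbf A,\boldsymbol\lambda)$ is rectangular.
   Context: For $A:\mathcal H\rightrightarrows\mathcal H$: $\operatorname{gra}A=\{(x,u):u\in Ax\}$, $\operatorname{dom}A=\{x: Ax\neq\varnothing\}$, $\operatorname{ran}A=\bigcup_xAx$, and $A^{-1}$ is the set-valued mapping with $x\in A^{-1}u\Leftrightarrow u\in Ax$. A monotone mapping $A$ is rectangular (also known as $3^*$ monotone) if for every $x\in\operatorname{dom}A$ and every $v\in\operatorname{ran}A$, $$\inf_{(z,w)\in\operatorname{gra}A}\langle v-w,x-z\rangle>-\infty.$$ Sums and scalar multiples of set-valued mappings are pointwise Minkowski operations; $\mathrm{Id}$ is the identity. The $\boldsymbol\lambda$-weighted resolvent average of $\mathbf A$ with parameter $\mu$ is the set-valued mapping $$\mathcal R_\mu(\mathbf A,\boldsymbol\lambda)=\Big(\sum_{i\in I}\lambda_i(A_i+\mu^{-1}\mathrm{Id})^{-1}\Big)^{-1}-\mu^{-1}\mathrm{Id}.$$ *)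

theory Defs
  imports "HOL-Analysis.Analysis" "HOL-Library.Set_Algebras" "HOL-Library.Extended_Real"
begin

text \<open>
  A set-valued mapping on \<open>H\<close> is a function \<open>H \<Rightarrow> H set\<close>. The sum of two sets, and
  hence the finite sum of a family of sets, is the Minkowski sum of
  \<^theory>\<open>HOL-Library.Set_Algebras\<close>.
\<close>

type_synonym 'a setmap = "'a \<Rightarrow> 'a set"

definition gra_map :: "'a setmap \<Rightarrow> ('a \<times> 'a) set" where
  "gra_map A = {(x, u). u \<in> A x}"

definition dom_map :: "'a setmap \<Rightarrow> 'a set" where
  "dom_map A = {x. A x \<noteq> {}}"

definition ran_map :: "'a setmap \<Rightarrow> 'a set" where
  "ran_map A = (\<Union>x. A x)"

definition inv_map :: "'a setmap \<Rightarrow> 'a setmap" where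
  "inv_map A = (\<lambda>u. {x. u \<in> A x})"

definition Id_map :: "'a setmap" where
  "Id_map = (\<lambda>x. {x})"

definition add_map :: "'a::plus setmap \<Rightarrow> 'a setmap \<Rightarrow> 'a setmap" where
  "add_map A B = (\<lambda>x. A x + B x)"

definition diff_map :: "'a::minus setmap \<Rightarrow> 'a setmap \<Rightarrow> 'a setmap" where
  "diff_map A B = (\<lambda>x. {u - v |u v. u \<in> A x \<and> v \<in> B x})"

definition scale_map :: "real \<Rightarrow> 'a::real_vector setmap \<Rightarrow> 'a setmap" where
  "scale_map c A = (\<lambda>x. (\<lambda>u. c *\<^sub>R u) ` A x)"

definition sum_map :: "'i set \<Rightarrow> ('i \<Rightarrow> 'a::comm_monoid_add setmap) \<Rightarrow> 'a setmap" where
  "sum_map I F = (\<lambda>x. \<Sum>i\<in>I. F i x)"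

definition monotone_map :: "'a::real_inner setmap \<Rightarrow> bool" where
  "monotone_map A \<longleftrightarrow> (\<forall>(x, u)\<in>gra_map A. \<forall>(y, v)\<in>gra_map A. (x - y) \<bullet> (u - v) \<ge> 0)"

definition maximally_monotone :: "'a::real_inner setmap \<Rightarrow> bool" where
  "maximally_monotone A \<longleftrightarrow>
     monotone_map A \<and> (\<forall>B. monotone_map B \<and> gra_map A \<subseteq> gra_map B \<longrightarrow> gra_map B = gra_map A)"

text \<open>
  The infimum is taken in the extended reals, since as an infimum of reals it would have an
  unspecified value on a set unbounded below.
\<close>

definition rectangular :: "'a::real_inner setmap \<Rightarrow> bool" where
  "rectangular A \<longleftrightarrow>
     monotone_map A \<and>
     (\<forall>x\<in>dom_map A. \<forall>v\<in>ran_map A. (INF (z, w)\<in>gra_map A. ereal ((v - w) \<bullet> (x - z))) > -\<infinity>)"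

definition resolvent_average ::
    "real \<Rightarrow> 'i set \<Rightarrow> ('i \<Rightarrow> 'a::real_vector setmap) \<Rightarrow> ('i \<Rightarrow> real) \<Rightarrow> 'a setmap" where
  "resolvent_average \<mu> I A l =
     diff_map
       (inv_map (sum_map I (\<lambda>i. scale_map (l i)
          (inv_map (add_map (A i) (scale_map (inverse \<mu>) Id_map))))))
       (scale_map (inverse \<mu>) Id_map)"

end

theory Submission
  imports Defs
begin

text \<open>
  Put \<open>r = 1/\<mu>\<close>. A point \<open>(x, u)\<close> lies in the graph of the resolvent average iff there are
  points \<open>a\<^sub>i\<close> and a common vector \<open>s\<close> with \<open>s - r a\<^sub>i \<in> A\<^sub>i a\<^sub>i\<close>, \<open>x = \<Sum> \<lambda>\<^sub>i a\<^sub>i\<close> and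
  \<open>u = s - r x\<close> (\<open>resolvent_average_iff\<close>). So \<open>x\<close> and \<open>u\<close> are the averages of the points \<open>a\<^sub>i\<close> and of
  the values \<open>s - r a\<^sub>i\<close>.

  Let \<open>x\<close> in the domain come from \<open>(a\<^sub>i)\<close>, let \<open>v\<close> in the range come from \<open>(b\<^sub>i, t)\<close>, and let
  \<open>(z, w)\<close> in the graph come from \<open>(z\<^sub>i, s)\<close>. With \<open>v\<^sub>i = t - r b\<^sub>i\<close> and \<open>w\<^sub>i = s - r z\<^sub>i\<close>, put
  \<open>d\<^sub>i = a\<^sub>i - z\<^sub>i\<close> and \<open>c\<^sub>i = r (a\<^sub>i - b\<^sub>i)\<close>, with averages \<open>d\<close> and \<open>c\<close>. Then
  \<open>(v - w) \<bullet> (x - z) = (\<Sum> \<lambda>\<^sub>i (v\<^sub>i - w\<^sub>i) \<bullet> (a\<^sub>i - z\<^sub>i))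
      + (\<Sum> \<lambda>\<^sub>i (r |d\<^sub>i - d|\<^sup>2 - (c\<^sub>i - c) \<bullet> (d\<^sub>i - d)))\<close>.
  Rectangularity of the \<open>A\<^sub>i\<close> bounds the first sum from below, and completing the square bounds the
  second one by \<open>- \<Sum> \<lambda>\<^sub>i |c\<^sub>i - c|\<^sup>2 / (4 r)\<close>, which does not depend on \<open>(z, w)\<close>
  (\<open>inner_average_ge\<close>). When \<open>a\<^sub>i = b\<^sub>i\<close> every \<open>c\<^sub>i\<close> vanishes and the first sum is nonnegative,
  so the same inequality gives monotonicity.
\<close>

lemma rectangular_iff:
  "rectangular A \<longleftrightarrow> monotone_map A \<and>
     (\<forall>x y v. A x \<noteq> {} \<longrightarrow> v \<in> A y \<longrightarrow> (\<exists>K. \<forall>z w. w \<in> A z \<longrightarrow> K \<le> (v - w) \<bullet> (x - z)))"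
proof -
  have "(INF (z, w)\<in>gra_map A. ereal ((v - w) \<bullet> (x - z))) > -\<infinity> \<longleftrightarrow>
      (\<exists>K. \<forall>z w. w \<in> A z \<longrightarrow> K \<le> (v - w) \<bullet> (x - z))" for x v
  proof
    assume "(INF (z, w)\<in>gra_map A. ereal ((v - w) \<bullet> (x - z))) > -\<infinity>"
    then obtain K where K: "ereal K < (INF (z, w)\<in>gra_map A. ereal ((v - w) \<bullet> (x - z)))"
      using ereal_dense2 by blast
    have "K \<le> (v - w) \<bullet> (x - z)" if "w \<in> A z" for z w
    proof -
      have "(z, w) \<in> gra_map A"
        using that by (simp add: gra_map_def)
      from less_INF_D[OF K this] show ?thesis
        by simp
    qed
    then show "\<exists>K. \<forall>z w. w \<in> A z \<longrightarrow> K \<le> (v - w) \<bullet> (x - z)"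
      by blast
  next
    assume "\<exists>K. \<forall>z w. w \<in> A z \<longrightarrow> K \<le> (v - w) \<bullet> (x - z)"
    then obtain K where K: "\<And>z w. w \<in> A z \<Longrightarrow> K \<le> (v - w) \<bullet> (x - z)"
      by blast
    have "ereal K \<le> (INF (z, w)\<in>gra_map A. ereal ((v - w) \<bullet> (x - z)))"
      by (rule INF_greatest) (auto simp: gra_map_def K)
    then show "(INF (z, w)\<in>gra_map A. ereal ((v - w) \<bullet> (x - z))) > -\<infinity>"
      by (rule less_le_trans[rotated]) simp
  qed
  then show ?thesis
    unfolding rectangular_def dom_map_def ran_map_def by blast
qed

lemma resolvent_average_iff:
  fixes A :: "'i \<Rightarrow> 'a::real_vector setmap"
  assumes "finite I"
  shows "u \<in> resolvent_average \<mu> I A l x \<longleftrightarrow>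
    (\<exists>a s. x = (\<Sum>i\<in>I. l i *\<^sub>R a i) \<and> u = s - inverse \<mu> *\<^sub>R x \<and>
      (\<forall>i\<in>I. s - inverse \<mu> *\<^sub>R a i \<in> A i (a i)))"
proof -
  let ?r = "inverse \<mu>"
  have resolvent: "b \<in> inv_map (add_map (A i) (scale_map ?r Id_map)) s \<longleftrightarrow>
      s - ?r *\<^sub>R b \<in> A i b" for i b s
    by (force simp: inv_map_def add_map_def scale_map_def Id_map_def set_plus_def)
  have average: "x \<in> sum_map I (\<lambda>i. scale_map (l i)
          (inv_map (add_map (A i) (scale_map ?r Id_map)))) s \<longleftrightarrow>
      (\<exists>a. x = (\<Sum>i\<in>I. l i *\<^sub>R a i) \<and> (\<forall>i\<in>I. s - ?r *\<^sub>R a i \<in> A i (a i)))" (is "?L \<longleftrightarrow> ?R") for s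
  proof
    assume ?L
    then obtain p where p: "x = sum p I"
        "\<And>i. i \<in> I \<Longrightarrow> p i \<in> scale_map (l i) (inv_map (add_map (A i) (scale_map ?r Id_map))) s"
      using assms by (auto simp: sum_map_def set_sum_alt)
    then have "\<forall>i\<in>I. \<exists>b. p i = l i *\<^sub>R b \<and> s - ?r *\<^sub>R b \<in> A i b"
      using resolvent unfolding scale_map_def by blast
    then obtain a where "\<forall>i\<in>I. p i = l i *\<^sub>R a i \<and> s - ?r *\<^sub>R a i \<in> A i (a i)"
      by metis
    with p(1) show ?R
      by (auto intro!: exI[of _ a] sum.cong)
  next
    assume ?R
    then obtain a where "x = (\<Sum>i\<in>I. l i *\<^sub>R a i)" "\<forall>i\<in>I. s - ?r *\<^sub>R a i \<in> A i (a i)"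
      by blast
    then show ?L
      using assms resolvent unfolding sum_map_def set_sum_alt[OF assms] scale_map_def by blast
  qed
  have "u \<in> resolvent_average \<mu> I A l x \<longleftrightarrow>
      (\<exists>s. u = s - ?r *\<^sub>R x \<and> x \<in> sum_map I (\<lambda>i. scale_map (l i)
          (inv_map (add_map (A i) (scale_map ?r Id_map)))) s)"
    unfolding resolvent_average_def diff_map_def
    by (auto simp: inv_map_def scale_map_def Id_map_def)
  then show ?thesis
    unfolding average by blast
qed

text \<open>
  The quantitative core: the scalar product of the averages of \<open>\<sigma> + c\<^sub>i - r d\<^sub>i\<close> and of \<open>d\<^sub>i\<close> is at
  least the average of the scalar products, up to an error in which neither the \<open>d\<^sub>i\<close> nor the
  common vector \<open>\<sigma>\<close> occurs.
\<close>

lemma inner_average_ge: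
  fixes c d :: "'i \<Rightarrow> 'a::real_inner" and \<sigma> :: 'a
  assumes "r > 0" and nonneg: "\<And>i. i \<in> I \<Longrightarrow> l i \<ge> 0" and l1: "(\<Sum>i\<in>I. l i) = 1"
  defines "C \<equiv> \<Sum>i\<in>I. l i *\<^sub>R c i" and "D \<equiv> \<Sum>i\<in>I. l i *\<^sub>R d i"
  shows "(\<Sum>i\<in>I. l i * ((\<sigma> + c i - r *\<^sub>R d i) \<bullet> d i)) - (\<Sum>i\<in>I. l i * (norm (c i - C))\<^sup>2 / (4 * r))
    \<le> (\<sigma> + C - r *\<^sub>R D) \<bullet> D"
proof -
  \<comment> \<open>the difference of the two sides is the average of these squares, taken at
    \<open>y = d i - D\<close> and \<open>k = c i - C\<close>\<close>
  have square: "0 \<le> r * (y \<bullet> y) - k \<bullet> y + (norm k)\<^sup>2 / (4 * r)" for y k :: 'a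
  proof -
    have "r * (y \<bullet> y) - k \<bullet> y + (norm k)\<^sup>2 / (4 * r)
        = r * ((y - (1 / (2 * r)) *\<^sub>R k) \<bullet> (y - (1 / (2 * r)) *\<^sub>R k))"
      using \<open>r > 0\<close>
      by (simp add: power2_norm_eq_inner inner_diff_left inner_diff_right inner_commute field_simps)
    then show ?thesis
      using \<open>r > 0\<close> by simp
  qed
  have lin: "(\<Sum>i\<in>I. l i * (k \<bullet> d i)) = k \<bullet> D" "(\<Sum>i\<in>I. l i * (c i \<bullet> k)) = C \<bullet> k"
    "(\<Sum>i\<in>I. l i * k') = k'" for k k'
    by (simp_all add: C_def D_def inner_sum_left inner_sum_right l1 flip: sum_distrib_right)
  have "0 \<le> (\<Sum>i\<in>I. l i * (r * ((d i - D) \<bullet> (d i - D)) - (c i - C) \<bullet> (d i - D)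
      + (norm (c i - C))\<^sup>2 / (4 * r)))"
    by (intro sum_nonneg mult_nonneg_nonneg nonneg square)
  also have "\<dots> = (\<Sum>i\<in>I. l i * (\<sigma> \<bullet> d i) - l i * ((\<sigma> + c i - r *\<^sub>R d i) \<bullet> d i)
      + l i * (norm (c i - C))\<^sup>2 / (4 * r)
      - 2 * r * (l i * (D \<bullet> d i)) + l i * (r * (D \<bullet> D))
      + l i * (C \<bullet> d i) + l i * (c i \<bullet> D) - l i * (C \<bullet> D))"
    by (intro sum.cong refl) (simp add: inner_commute[of "d _" D] algebra_simps)
  also have "\<dots> = \<sigma> \<bullet> D - (\<Sum>i\<in>I. l i * ((\<sigma> + c i - r *\<^sub>R d i) \<bullet> d i))
      + (\<Sum>i\<in>I. l i * (norm (c i - C))\<^sup>2 / (4 * r))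
      - 2 * r * (D \<bullet> D) + r * (D \<bullet> D) + C \<bullet> D + C \<bullet> D - C \<bullet> D"
    by (simp only: sum.distrib sum_subtractf lin sum_distrib_left[symmetric])
  finally show ?thesis
    by (simp add: inner_diff_left inner_add_left)
qed

text \<open>
  The inequality in terms of the resolvent average; \<open>(a\<^sub>i)\<close> represents the point of the domain,
  \<open>(b\<^sub>i, t)\<close> the value in the range, and \<open>(e\<^sub>i, s)\<close> the point of the graph.
\<close>

lemma inner_resolvent_average_ge:
  fixes a b e :: "'i \<Rightarrow> 'a::real_inner" and s t :: 'a
  assumes "r > 0" and "\<And>i. i \<in> I \<Longrightarrow> l i \<ge> 0" and "(\<Sum>i\<in>I. l i) = 1"
    and K: "\<And>i. i \<in> I \<Longrightarrow> K i \<le> ((t - r *\<^sub>R b i) - (s - r *\<^sub>R e i)) \<bullet> (a i - e i)"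
  defines "av \<equiv> (\<lambda>f. \<Sum>i\<in>I. l i *\<^sub>R f i)"
  defines "c \<equiv> (\<lambda>i. r *\<^sub>R (a i - b i))"
  shows "(\<Sum>i\<in>I. l i * K i) - (\<Sum>i\<in>I. l i * (norm (c i - av c))\<^sup>2 / (4 * r))
    \<le> ((t - r *\<^sub>R av b) - (s - r *\<^sub>R av e)) \<bullet> (av a - av e)"
proof -
  have d: "(\<Sum>i\<in>I. l i *\<^sub>R (a i - e i)) = av a - av e"
    by (simp add: av_def sum_subtractf scaleR_diff_right)
  have c: "(\<Sum>i\<in>I. l i *\<^sub>R c i) = r *\<^sub>R (av a - av b)"
    by (simp add: av_def c_def sum_subtractf scaleR_diff_right scaleR_sum_right mult.commute)
  define err where "err = (\<Sum>i\<in>I. l i * (norm (c i - av c))\<^sup>2 / (4 * r))"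
  have "(\<Sum>i\<in>I. l i * K i)
      \<le> (\<Sum>i\<in>I. l i * ((t - s + c i - r *\<^sub>R (a i - e i)) \<bullet> (a i - e i)))"
    using assms(2) K by (intro sum_mono mult_left_mono) (auto simp: c_def algebra_simps)
  then have "(\<Sum>i\<in>I. l i * K i) - err
      \<le> (\<Sum>i\<in>I. l i * ((t - s + c i - r *\<^sub>R (a i - e i)) \<bullet> (a i - e i))) - err"
    by simp
  also have "\<dots> \<le> (t - s + av c - r *\<^sub>R (av a - av e)) \<bullet> (av a - av e)"
    using inner_average_ge[of r I l "t - s" c "\<lambda>i. a i - e i", OF assms(1-3)]
    unfolding d by (simp only: av_def err_def)
  also have "t - s + av c - r *\<^sub>R (av a - av e) = (t - r *\<^sub>R av b) - (s - r *\<^sub>R av e)"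
    using c by (simp add: av_def algebra_simps)
  finally show ?thesis
    by (simp only: err_def)
qed

theorem rectangular_resolvent_average:
  fixes A :: "'i \<Rightarrow> 'a::real_inner setmap"
  assumes "\<mu> > 0" and fin: "finite I"
    and l: "\<And>i. i \<in> I \<Longrightarrow> l i \<ge> 0" "(\<Sum>i\<in>I. l i) = 1"
    and A: "\<And>i. i \<in> I \<Longrightarrow> rectangular (A i)"
  shows "rectangular (resolvent_average \<mu> I A l)"
proof -
  define r where "r = inverse \<mu>"
  define R where "R = resolvent_average \<mu> I A l"
  have "r > 0"
    using \<open>\<mu> > 0\<close> by (simp add: r_def)
  have R: "u \<in> R x \<longleftrightarrow> (\<exists>a s. x = (\<Sum>i\<in>I. l i *\<^sub>R a i) \<and> u = s - r *\<^sub>R x \<and>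
      (\<forall>i\<in>I. s - r *\<^sub>R a i \<in> A i (a i)))" for x u
    unfolding R_def r_def by (rule resolvent_average_iff[OF fin])
  have "(x - z) \<bullet> (u - w) \<ge> 0" if "u \<in> R x" "w \<in> R z" for x u z w
  proof -
    obtain a t where a: "x = (\<Sum>i\<in>I. l i *\<^sub>R a i)" "u = t - r *\<^sub>R x"
      "\<forall>i\<in>I. t - r *\<^sub>R a i \<in> A i (a i)"
      using \<open>u \<in> R x\<close> unfolding R by blast
    obtain e s where e: "z = (\<Sum>i\<in>I. l i *\<^sub>R e i)" "w = s - r *\<^sub>R z"
      "\<forall>i\<in>I. s - r *\<^sub>R e i \<in> A i (e i)"
      using \<open>w \<in> R z\<close> unfolding R by blast
    have "0 \<le> ((t - r *\<^sub>R a i) - (s - r *\<^sub>R e i)) \<bullet> (a i - e i)" if "i \<in> I" for i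
      using A[OF that] a(3) e(3) that
      by (fastforce simp: rectangular_def monotone_map_def gra_map_def inner_commute)
    from inner_resolvent_average_ge[of r I l "\<lambda>_. 0", OF \<open>r > 0\<close> l this] show ?thesis
      by (simp add: a e inner_commute)
  qed
  moreover have "\<exists>K. \<forall>z w. w \<in> R z \<longrightarrow> K \<le> (v - w) \<bullet> (x - z)"
    if "R x \<noteq> {}" "v \<in> R y" for x y v
  proof -
    obtain a t' where a: "x = (\<Sum>i\<in>I. l i *\<^sub>R a i)" "\<forall>i\<in>I. t' - r *\<^sub>R a i \<in> A i (a i)"
      using \<open>R x \<noteq> {}\<close> R by blast
    obtain b t where b: "y = (\<Sum>i\<in>I. l i *\<^sub>R b i)" "v = t - r *\<^sub>R y"
      "\<forall>i\<in>I. t - r *\<^sub>R b i \<in> A i (b i)"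
      using \<open>v \<in> R y\<close> unfolding R by blast
    have "\<forall>i\<in>I. \<exists>K. \<forall>z w. w \<in> A i z \<longrightarrow> K \<le> ((t - r *\<^sub>R b i) - w) \<bullet> (a i - z)"
    proof
      fix i assume "i \<in> I"
      then have "A i (a i) \<noteq> {}" "t - r *\<^sub>R b i \<in> A i (b i)"
        using a(2) b(3) by auto
      then show "\<exists>K. \<forall>z w. w \<in> A i z \<longrightarrow> K \<le> ((t - r *\<^sub>R b i) - w) \<bullet> (a i - z)"
        using A[OF \<open>i \<in> I\<close>] unfolding rectangular_iff by blast
    qed
    then obtain K where
      K: "\<forall>i\<in>I. \<forall>z w. w \<in> A i z \<longrightarrow> K i \<le> ((t - r *\<^sub>R b i) - w) \<bullet> (a i - z)"
      by metis
    define c where "c = (\<lambda>i. r *\<^sub>R (a i - b i))"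
    define M where "M = (\<Sum>i\<in>I. l i * K i)
      - (\<Sum>i\<in>I. l i * (norm (c i - (\<Sum>j\<in>I. l j *\<^sub>R c j)))\<^sup>2 / (4 * r))"
    have "M \<le> (v - w) \<bullet> (x - z)" if "w \<in> R z" for z w
    proof -
      obtain e s where e: "z = (\<Sum>i\<in>I. l i *\<^sub>R e i)" "w = s - r *\<^sub>R z"
        "\<forall>i\<in>I. s - r *\<^sub>R e i \<in> A i (e i)"
        using \<open>w \<in> R z\<close> unfolding R by blast
      have "K i \<le> ((t - r *\<^sub>R b i) - (s - r *\<^sub>R e i)) \<bullet> (a i - e i)" if "i \<in> I" for i
        using K e(3) that by blast
      from inner_resolvent_average_ge[of r I l K, OF \<open>r > 0\<close> l this] show ?thesis
        unfolding M_def c_def a(1) b(1,2) e(1,2) by simp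
    qed
    then show ?thesis
      by blast
  qed
  ultimately have "rectangular R"
    unfolding rectangular_iff by (auto simp: monotone_map_def gra_map_def)
  then show ?thesis
    by (simp add: R_def)
qed

theorem theorem4p5:
  fixes \<mu> :: real and n :: nat and l :: "nat \<Rightarrow> real"
    and A :: "nat \<Rightarrow> 'a::{real_inner, complete_space} \<Rightarrow> 'a set"
  assumes "\<mu> > 0" and "n \<ge> 1"
    and "\<And>i. i \<in> {1..n} \<Longrightarrow> l i > 0" and "(\<Sum>i\<in>{1..n}. l i) = 1"
    and "\<And>i. i \<in> {1..n} \<Longrightarrow> rectangular (A i)"
    and "\<And>i. i \<in> {1..n} \<Longrightarrow> maximally_monotone (A i)"
  shows "rectangular (resolvent_average \<mu> {1..n} A l)"
  using assms(1,3,4,5) by (intro rectangular_resolvent_average) (auto intro: less_imp_le)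

end
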